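(* Let $1\le k\le M$ and $x>0$. Let $\rho_i=\min\{|g_i|^2,|h_i|^2\}$, let $i^*$ be the index of the $k$-th largest among $\rho_1,\dots,\rho_M$ (max-min selection, MMS), and $\Pi^{(k)}_{\rm MMS}(x)=\mathbb P\{X_{i^*}\le x\}$. With all other parameters fixed, $$\Pi^\infty_{\rm MMS}(x):=\lim_{P_t\to\infty}\Pi^{(k)}_{\rm MMS}(x)=k\binom Mk\sum_{m=0}^{M-k}(-1)^m\binom{M-k}{m}\left(\frac{1-\exp(-2\delta r)}{\delta}-\frac{\exp(-r)-\exp(-2\delta r)}{2\delta-1}\right),$$ where $\delta=k+m$ and $r=\frac{\sigma_n^2ct_2x}{t_1(ac-b)}$.
   Context: There are $M\ge 1$ devices. The channel gains $|g_1|^2,\dots,|g_M|^2,|h_1|^2,\dots,|h_M|^2$ are independent exponential random variables with mean $1$. Parameters: $P_t>0$, $\sigma_n^2>0$, $0<t_1<1$, $t_2=1-t_1$, and real constants $a,b,c$ with $c>0$ and $ac-b>0$. The energy harvested by device $i$ is $E_i=t_1\left(\frac{aP_t|g_i|^2+b}{P_t|g_i|^2+c}-\frac bc\right)$, and the SNR of device $i$ is $X_i=\frac{|h_i|^2}{t_2\sigma_n^2}E_i$. *)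

theory Defs
  imports "HOL-Probability.Probability"
begin

definition harvested_energy ::
  "real \<Rightarrow> real \<Rightarrow> real \<Rightarrow> real \<Rightarrow> real \<Rightarrow> complex \<Rightarrow> real" where
  "harvested_energy t1 a b c Pt gi =
     t1 * ((a * Pt * (cmod gi)\<^sup>2 + b) / (Pt * (cmod gi)\<^sup>2 + c) - b / c)"

definition snr ::
  "real \<Rightarrow> real \<Rightarrow> real \<Rightarrow> real \<Rightarrow> real \<Rightarrow> real \<Rightarrow> real \<Rightarrow> complex \<Rightarrow> complex \<Rightarrow> real" where
  "snr sigma_n t1 t2 a b c Pt gi hi =
     (cmod hi)\<^sup>2 / (t2 * sigma_n\<^sup>2) * harvested_energy t1 a b c Pt gi"

(* The sort is stable, so equal values are ranked by increasing index.  For the continuous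
   channel gains used here ties have probability 0, so the tie-breaking rule is immaterial. *)
definition kth_largest_index :: "nat \<Rightarrow> nat \<Rightarrow> (nat \<Rightarrow> real) \<Rightarrow> nat" where
  "kth_largest_index M k v = sort_key (\<lambda>i. - v i) [1..<Suc M] ! (k - 1)"

definition mms_index ::
  "nat \<Rightarrow> nat \<Rightarrow> (nat \<Rightarrow> complex) \<Rightarrow> (nat \<Rightarrow> complex) \<Rightarrow> nat" where
  "mms_index M k g h = kth_largest_index M k (\<lambda>i. min ((cmod (g i))\<^sup>2) ((cmod (h i))\<^sup>2))"

definition Pi_MMS ::
  "'w measure \<Rightarrow> nat \<Rightarrow> nat \<Rightarrow> (nat \<Rightarrow> 'w \<Rightarrow> complex) \<Rightarrow> (nat \<Rightarrow> 'w \<Rightarrow> complex) \<Rightarrow>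
   real \<Rightarrow> real \<Rightarrow> real \<Rightarrow> real \<Rightarrow> real \<Rightarrow> real \<Rightarrow> real \<Rightarrow> real \<Rightarrow> real" where
  "Pi_MMS \<Omega> M k g h sigma_n t1 t2 a b c Pt x =
     measure \<Omega> {\<omega> \<in> space \<Omega>.
       (let i = mms_index M k (\<lambda>j. g j \<omega>) (\<lambda>j. h j \<omega>)
        in snr sigma_n t1 t2 a b c Pt (g i \<omega>) (h i \<omega>)) \<le> x}"

end

(* For P_t -> infinity the harvester saturates at t1 (a - b/c) as soon as |g_i| > 0, so almost
   surely the event X_{i*} <= x becomes |h_{i*}|^2 <= r, and dominated convergence gives the limit
   P(|h_{i*}|^2 <= r).  Split this event over the value i of i* and the set S of the k - 1 devices
   ranked above i.  Given (|g_i|^2, |h_i|^2) with minimum y, the other minima are independent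
   exponentials of rate 2, so S is this set with probability
   exp(-2y)^(k-1) (1 - exp(-2y))^(M-k).  There are M binom(M-1, k-1) = k binom(M, k) pairs (i, S);
   expanding the power of 1 - exp(-2y) and integrating over |h_i|^2 <= r gives the sum. *)

theory Submission
  imports Defs
begin

subsection \<open>Ranking by a stable sort\<close>

text \<open>Ties are broken by the index exactly as the stable sort does, so the ranking is a strict
  total order for every outcome and ties need not be discarded as a null event.\<close>

definition beats :: "(nat \<Rightarrow> real) \<Rightarrow> nat \<Rightarrow> nat \<Rightarrow> bool" where
  "beats v j i \<longleftrightarrow> (if j < i then v i \<le> v j else v i < v j)"

text \<open>The lexicographic form serves the order arguments. The form by cases serves the
  probability computations: for fixed \<open>i\<close> and \<open>j\<close> it is one threshold
  condition on \<open>v j\<close>.\<close>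

lemma beats_iff: "beats v j i \<longleftrightarrow> v i < v j \<or> v i = v j \<and> j < i"
  by (simp add: beats_def le_less)

lemma beats_irrefl: "\<not> beats v i i"
  by (simp add: beats_def)

lemma beats_trans: "beats v i j \<Longrightarrow> beats v j l \<Longrightarrow> beats v i l"
  by (auto simp: beats_iff)

lemma beats_total: "i \<noteq> j \<Longrightarrow> beats v i j \<or> beats v j i"
  by (auto simp: beats_iff)

text \<open>\<open>insort_key\<close> puts the new entry before entries with an equal key. The entry
  inserted has the smallest index so far, as happens when an increasing list is sorted from its end,
  so ties go to the smaller index, as \<open>beats\<close> demands.\<close>

lemma sorted_wrt_beats_insort_key:
  assumes "sorted_wrt (beats v) ys" and "\<And>y. y \<in> set ys \<Longrightarrow> x < y"
  shows "sorted_wrt (beats v) (insort_key (\<lambda>i. - v i) x ys)"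
  using assms
proof (induction ys)
  case Nil
  then show ?case by simp
next
  case (Cons y ys)
  have y: "x < y" "\<And>z. z \<in> set ys \<Longrightarrow> beats v y z"
    using Cons.prems by auto
  show ?case
  proof (cases "v y \<le> v x")
    case True
    then have "beats v x y"
      using y(1) by (auto simp: beats_iff)
    then show ?thesis
      using True Cons.prems(1) y(2) beats_trans by auto
  next
    case False
    then have "beats v y x"
      by (auto simp: beats_iff)
    then show ?thesis
      using False Cons by (auto simp: set_insort_key)
  qed
qed

lemma sorted_wrt_beats_sort_key:
  "sorted_wrt (<) xs \<Longrightarrow> sorted_wrt (beats v) (sort_key (\<lambda>i. - v i) xs)"
  by (induction xs) (auto simp: sort_key_simps intro!: sorted_wrt_beats_insort_key)

lemma card_beats_nth:
  assumes "sorted_wrt (beats v) xs" and "distinct xs" and "n < length xs"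
  shows "card {j \<in> set xs. beats v j (xs ! n)} = n"
proof -
  have "{j \<in> set xs. beats v j (xs ! n)} = (!) xs ` {..<n}"
  proof (intro equalityI subsetI)
    fix j assume "j \<in> {j \<in> set xs. beats v j (xs ! n)}"
    then obtain m where m: "m < length xs" "j = xs ! m" "beats v (xs ! m) (xs ! n)"
      by (auto simp: in_set_conv_nth)
    \<comment> \<open>For \<open>n = m\<close> this is irreflexivity. For \<open>n < m\<close>
      sortedness makes entry \<open>n\<close> beat entry \<open>m\<close>, and transitivity would
      make entry \<open>m\<close> beat itself.\<close>
    have "\<not> n \<le> m"
      using m assms sorted_wrt_nth_less[OF assms(1), of n m] beats_trans[of v "xs ! m" "xs ! n" "xs ! m"]
        beats_irrefl by (cases "n = m") auto
    then show "j \<in> (!) xs ` {..<n}"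
      using m by auto
  next
    fix j assume "j \<in> (!) xs ` {..<n}"
    then show "j \<in> {j \<in> set xs. beats v j (xs ! n)}"
      using sorted_wrt_nth_less[OF assms(1)] assms(3) by auto
  qed
  moreover have "inj_on ((!) xs) {..<n}"
    using assms by (auto simp: inj_on_def nth_eq_iff_index_eq)
  ultimately show ?thesis
    by (simp add: card_image)
qed

text \<open>By transitivity whatever beats \<open>i\<close> also beats \<open>j\<close>, and
  \<open>i\<close> itself is an additional element of the larger set. Hence no two indices share a
  rank.\<close>

lemma card_beats_less:
  assumes "finite I" and "i \<in> I" and "beats v i j"
  shows "card {l \<in> I. beats v l i} < card {l \<in> I. beats v l j}"
proof (rule psubset_card_mono)
  have "{l \<in> I. beats v l i} \<subseteq> {l \<in> I. beats v l j}"
    using assms beats_trans by blast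
  then show "{l \<in> I. beats v l i} \<subset> {l \<in> I. beats v l j}"
    using assms beats_irrefl by blast
qed (use assms in simp)

text \<open>Replaces sorting by counting, so that selection becomes a condition on comparisons. The
  count is \<open>k - 1\<close> because only the devices ranked strictly above \<open>i\<close> are
  counted.\<close>

lemma kth_largest_index_eq_iff:
  assumes "1 \<le> k" and "k \<le> M"
  shows "kth_largest_index M k v = i \<longleftrightarrow>
    i \<in> {1..M} \<and> card {j \<in> {1..M}. beats v j i} = k - 1"
proof -
  define xs where "xs = sort_key (\<lambda>i. - v i) [1..<Suc M]"
  define i' where "i' = kth_largest_index M k v"
  have set_xs: "set xs = {1..M}" and len: "length xs = M" and "distinct xs"
    unfolding xs_def by (auto simp: set_sort)
  have "sorted_wrt (beats v) xs"
    unfolding xs_def by (intro sorted_wrt_beats_sort_key) (simp del: upt_Suc)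
  have i'_nth: "i' = xs ! (k - 1)"
    unfolding i'_def kth_largest_index_def xs_def ..
  have card: "card {j \<in> {1..M}. beats v j i'} = k - 1"
    using card_beats_nth[OF \<open>sorted_wrt (beats v) xs\<close> \<open>distinct xs\<close>, of "k - 1"] assms len
    unfolding i'_nth set_xs by simp
  have i': "i' \<in> {1..M}"
    using nth_mem[of "k - 1" xs] assms len unfolding i'_nth set_xs by simp
  have "i = i'" if "i \<in> {1..M}" "card {j \<in> {1..M}. beats v j i} = k - 1" for i
  proof (rule ccontr)
    assume "i \<noteq> i'"
    then consider "beats v i i'" | "beats v i' i"
      using beats_total by blast
    then show False
    proof cases
      case 1
      from card_beats_less[OF _ that(1) this] show False
        unfolding that(2) card by simp
    next
      case 2
      from card_beats_less[OF _ i' this] show False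
        unfolding that(2) card by simp
    qed
  qed
  then show ?thesis
    using card i' unfolding i'_def by blast
qed

subsection \<open>The exponential law\<close>

abbreviation unit_exponential :: "real measure" where
  "unit_exponential \<equiv> density lborel (exponential_density 1)"

interpretation unit_exponential: prob_space unit_exponential
  by (rule prob_space_exponential_density) simp

lemma AE_unit_exponential_nonneg: "AE x in unit_exponential. 0 \<le> x"
  by (subst AE_density) (auto simp: exponential_density_def)

lemma AE_unit_exponential_neq: "AE x in unit_exponential. x \<noteq> y"
  using AE_lborel_singleton[of y] by (subst AE_density) auto

lemma integral_exp_Icc:
  assumes "p \<noteq> 0" and "0 \<le> h"
  shows "(\<integral>x. indicator {0..h} x * exp (- p * x) \<partial>lborel) = (1 - exp (- p * h)) / (p::real)"
proof -
  have "(\<integral>x. indicator {0..h} x *\<^sub>R exp (- p * x) \<partial>lborel)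
      = - exp (- p * h) / p - (- exp (- p * 0) / p)"
    using assms
    by (intro integral_FTC_atLeastAtMost continuous_intros)
       (auto intro!: derivative_eq_intros simp flip: has_real_derivative_iff_has_vector_derivative)
  then show ?thesis
    by (simp add: diff_divide_distrib)
qed

lemma integral_unit_exponential_exp_atMost:
  assumes "0 \<le> q" and "0 \<le> h"
  shows "(\<integral>x. indicator {..h} x * exp (- q * x) \<partial>unit_exponential)
    = (1 - exp (- (q + 1) * h)) / (q + 1)"
proof -
  have "(\<integral>x. indicator {..h} x * exp (- q * x) \<partial>unit_exponential)
      = (\<integral>x. exponential_density 1 x *\<^sub>R (indicator {..h} x * exp (- q * x)) \<partial>lborel)"
    by (intro integral_density) (auto simp: exponential_density_def)
  \<comment> \<open>The density vanishes on negative arguments, which cuts \<open>{..h}\<close> down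
    to \<open>{0..h}\<close>, and elsewhere contributes \<open>exp (- x)\<close>, which raises the
    rate from \<open>q\<close> to \<open>q + 1\<close>.\<close>
  also have "\<dots> = (\<integral>x. indicator {0..h} x * exp (- (q + 1) * x) \<partial>lborel)"
    by (intro Bochner_Integration.integral_cong)
       (auto simp: exponential_density_def indicator_def algebra_simps simp flip: exp_add)
  finally show ?thesis
    using integral_exp_Icc[of "q + 1" h] assms by simp
qed

lemma measure_unit_exponential_greaterThan:
  assumes "0 \<le> h"
  shows "measure unit_exponential {h<..} = exp (- h)"
proof -
  have "distributed unit_exponential lborel (\<lambda>x. x) (exponential_density 1)"
    by (auto simp: distributed_def distr_id2)
  from unit_exponential.exponential_distributedD_gt[OF this assms]
  show ?thesis
    by (simp add: greaterThan_def)
qed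

lemma measure_unit_exponential_atLeast:
  assumes "0 \<le> h"
  shows "measure unit_exponential {h..} = exp (- h)"
proof -
  have "measure unit_exponential {h..} = measure unit_exponential {h<..}"
    using AE_unit_exponential_neq[of h]
    by (intro unit_exponential.finite_measure_eq_AE) auto
  then show ?thesis
    using assms by (simp add: measure_unit_exponential_greaterThan)
qed

text \<open>Split at \<open>x = h\<close>: below, the minimum is \<open>x\<close>; above, it is the
  constant \<open>h\<close>, weighted by the tail probability \<open>exp (- h)\<close>.\<close>

lemma integral_unit_exponential_exp_min:
  assumes "0 \<le> q" and "0 \<le> h"
  shows "(\<integral>x. exp (- q * min x h) \<partial>unit_exponential)
    = 1 / (q + 1) + q / (q + 1) * exp (- (q + 1) * h)"
proof -
  have "integrable unit_exponential (\<lambda>x. indicator {..h} x * exp (- q * x))"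
  proof (rule unit_exponential.integrable_const_bound[where B = 1])
    show "AE x in unit_exponential. norm (indicator {..h} x * exp (- q * x)) \<le> 1"
      using AE_unit_exponential_nonneg
      by eventually_elim (use assms in \<open>auto simp: indicator_def\<close>)
  qed simp
  moreover have "integrable unit_exponential (\<lambda>x. indicator {h<..} x * exp (- q * h))"
    by (intro integrable_mult_left unit_exponential.integrable_const_bound[where B = 1]) auto
  moreover have "(\<integral>x. exp (- q * min x h) \<partial>unit_exponential) =
      (\<integral>x. indicator {..h} x * exp (- q * x) + indicator {h<..} x * exp (- q * h) \<partial>unit_exponential)"
    by (intro Bochner_Integration.integral_cong) (auto simp: indicator_def min_def)
  ultimately have "(\<integral>x. exp (- q * min x h) \<partial>unit_exponential)
      = (1 - exp (- (q + 1) * h)) / (q + 1) + exp (- h) * exp (- q * h)"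
    using assms integral_unit_exponential_exp_atMost[OF assms]
    by (simp add: measure_unit_exponential_greaterThan)
  also have "exp (- h) * exp (- q * h) = exp (- (q + 1) * h)"
    by (simp add: algebra_simps flip: exp_add)
  finally show ?thesis
    using assms by (simp add: field_simps)
qed

section \<open>Pairs of independent unit exponentials\<close>

abbreviation unit_exponential2 :: "(real \<times> real) measure" where
  "unit_exponential2 \<equiv> unit_exponential \<Otimes>\<^sub>M unit_exponential"

interpretation unit_exponential2: pair_prob_space unit_exponential unit_exponential ..

lemma AE_unit_exponential2_nonneg:
  "AE z in unit_exponential2. 0 \<le> min (fst z) (snd z)"
proof (rule unit_exponential2.AE_pair_measure)
  show "{z \<in> space unit_exponential2. 0 \<le> min (fst z) (snd z)} \<in> sets unit_exponential2"
    by measurable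
  show "AE x in unit_exponential. AE y in unit_exponential. 0 \<le> min (fst (x, y)) (snd (x, y))"
    using AE_unit_exponential_nonneg
  proof eventually_elim
    case (elim x)
    show ?case
      using AE_unit_exponential_nonneg by eventually_elim (use elim in simp)
  qed
qed

text \<open>The integrand is bounded by 1 where both coordinates are nonnegative, and that quadrant
  carries all the mass.\<close>

lemma integrable_unit_exponential2_exp_min:
  assumes "0 \<le> q"
  shows "integrable unit_exponential2
    (\<lambda>z. indicator {..r} (snd z) * exp (- q * min (fst z) (snd z)))"
proof (rule unit_exponential2.integrable_const_bound[where B = 1])
  show "AE z in unit_exponential2. norm (indicator {..r} (snd z) * exp (- q * min (fst z) (snd z))) \<le> 1"
    using AE_unit_exponential2_nonneg
    by eventually_elim (use assms in \<open>auto simp: indicator_def\<close>)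
qed measurable

text \<open>The second coordinate is integrated last because the indicator depends on it alone. The
  inner integral is a constant plus a multiple of \<open>exp (- (q + 1) * h)\<close>; integrating
  these over \<open>h\<close> against the density gives the rates 1 and
  \<open>q + 2\<close>.\<close>

lemma integral_unit_exponential2_exp_min:
  assumes "0 \<le> q" and "0 \<le> r"
  shows "(\<integral>z. indicator {..r} (snd z) * exp (- q * min (fst z) (snd z)) \<partial>unit_exponential2)
    = (1 - exp (- r)) / (q + 1) + q / (q + 1) * ((1 - exp (- (q + 2) * r)) / (q + 2))"
proof -
  let ?I = "\<lambda>p. \<lambda>h::real. indicator {..r} h * exp (- p * h)"
  have int: "integrable unit_exponential (?I p)" if "0 \<le> p" for p
  proof (rule unit_exponential.integrable_const_bound[where B = 1])
    show "AE x in unit_exponential. norm (?I p x) \<le> 1"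
      using AE_unit_exponential_nonneg
      by eventually_elim (use that in \<open>auto simp: indicator_def\<close>)
  qed simp
  have "(\<integral>z. indicator {..r} (snd z) * exp (- q * min (fst z) (snd z)) \<partial>unit_exponential2)
      = (\<integral>h. (\<integral>g. indicator {..r} h * exp (- q * min g h) \<partial>unit_exponential) \<partial>unit_exponential)"
    using integrable_unit_exponential2_exp_min[OF assms(1), of r]
    by (subst unit_exponential2.integral_snd) (simp_all add: case_prod_unfold)
  also have "\<dots> = (\<integral>h. 1 / (q + 1) * ?I 0 h + q / (q + 1) * ?I (q + 1) h \<partial>unit_exponential)"
  proof (intro integral_cong_AE)
    show "AE h in unit_exponential. (\<integral>g. indicator {..r} h * exp (- q * min g h) \<partial>unit_exponential)
      = 1 / (q + 1) * ?I 0 h + q / (q + 1) * ?I (q + 1) h"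
      using AE_unit_exponential_nonneg
      by eventually_elim
        (simp add: integral_unit_exponential_exp_min[OF assms(1), simplified] algebra_simps)
  qed measurable
  also have "\<dots> = 1 / (q + 1) * (\<integral>h. ?I 0 h \<partial>unit_exponential)
      + q / (q + 1) * (\<integral>h. ?I (q + 1) h \<partial>unit_exponential)"
    using int[of 0] int[of "q + 1"] assms(1)
    by (subst Bochner_Integration.integral_add) (simp_all del: minus_add_distrib)
  also have "(\<integral>h. ?I 0 h \<partial>unit_exponential) = 1 - exp (- r)"
    using integral_unit_exponential_exp_atMost[of 0 r] assms(2) by simp
  also have "(\<integral>h. ?I (q + 1) h \<partial>unit_exponential) = (1 - exp (- (q + 2) * r)) / (q + 2)"
    using integral_unit_exponential_exp_atMost[of "q + 1" r] assms by (simp add: add.assoc)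
  finally show ?thesis
    by simp
qed

text \<open>Both events are squares of half-lines, hence the rate 2. The two versions are needed
  because tie-breaking makes the threshold non-strict for smaller indices and strict for larger
  ones.\<close>

lemma measure_unit_exponential2_min:
  assumes "0 \<le> y"
  shows "measure unit_exponential2 {z. y < min (fst z) (snd z)} = exp (- 2 * y)"
    and "measure unit_exponential2 {z. y \<le> min (fst z) (snd z)} = exp (- 2 * y)"
proof -
  have Times: "measure unit_exponential2 (A \<times> A) = measure unit_exponential A * measure unit_exponential A"
    if "A \<in> sets borel" for A
    using that
    by (simp add: measure_def unit_exponential.emeasure_pair_measure_Times enn2real_mult)
  have "{z. y < min (fst z) (snd z)} = {y<..} \<times> {y<..}"
    and "{z. y \<le> min (fst z) (snd z)} = {y..} \<times> {y..}"
    by auto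
  then show "measure unit_exponential2 {z. y < min (fst z) (snd z)} = exp (- 2 * y)"
    and "measure unit_exponential2 {z. y \<le> min (fst z) (snd z)} = exp (- 2 * y)"
    using assms
    by (simp_all add: Times measure_unit_exponential_greaterThan measure_unit_exponential_atLeast
        flip: exp_add)
qed

subsection \<open>The law of the selected pair\<close>

interpretation unit_exponential2_PiM:
  product_prob_space "\<lambda>_::nat. unit_exponential2" UNIV ..

text \<open>A pair stands for the two squared gains of one device, that of \<open>g\<close> first,
  so this is its ranking score.\<close>

definition pair_min :: "real \<times> real \<Rightarrow> real" where
  "pair_min z = min (fst z) (snd z)"

lemma measurable_pair_min [measurable]: "pair_min \<in> borel_measurable (borel \<Otimes>\<^sub>M borel)"
  unfolding pair_min_def by measurable

lemma pred_beats:
  assumes "finite I" and "i \<in> I"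
  shows "Measurable.pred (PiM I (\<lambda>_. unit_exponential2))
    (\<lambda>z. \<forall>j\<in>I. beats (\<lambda>j. pair_min (z j)) j i \<longleftrightarrow> j \<in> S)"
proof -
  let ?P = "PiM I (\<lambda>_. unit_exponential2)"
  have f: "(\<lambda>z. pair_min (z j)) \<in> borel_measurable ?P" if [measurable]: "j \<in> I" for j
    by measurable
  have "Measurable.pred ?P (\<lambda>z. beats (\<lambda>j. pair_min (z j)) j i)" if "j \<in> I" for j
    using borel_measurable_le[OF f[OF assms(2)] f[OF that]]
      borel_measurable_less[OF f[OF assms(2)] f[OF that]]
    by (simp add: beats_def pred_def)
  then have [measurable]: "Measurable.pred ?P (\<lambda>z. beats (\<lambda>j. pair_min (z j)) j i \<longleftrightarrow> j \<in> S)"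
    if "j \<in> I" for j
    using that by (cases "j \<in> S") (simp_all add: pred_intros_logic)
  show ?thesis
    using assms(1) by measurable
qed

text \<open>Fubini with coordinate \<open>i\<close> outermost: once it is fixed to \<open>y\<close>,
  each other device beats it or not independently, so the event is a box in the remaining
  coordinates. Devices in \<open>S\<close> contribute \<open>exp (- 2 * pair_min y)\<close> each,
  the others its complement.\<close>

lemma measure_beats_eq:
  assumes "finite J" and "i \<notin> J" and "S \<subseteq> J"
  defines "P \<equiv> PiM (insert i J) (\<lambda>_. unit_exponential2)"
  shows "measure P {z \<in> space P. snd (z i) \<le> r \<and>
      (\<forall>j\<in>insert i J. beats (\<lambda>j. pair_min (z j)) j i \<longleftrightarrow> j \<in> S)}
    = (\<integral>y. indicator {..r} (snd y) *
        (exp (- 2 * pair_min y) ^ card S * (1 - exp (- 2 * pair_min y)) ^ card (J - S))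
        \<partial>unit_exponential2)" (is "measure P ?A = (\<integral>y. ?f y \<partial>_)")
proof -
  let ?N = "PiM J (\<lambda>_. unit_exponential2)"
  interpret P: prob_space P
    unfolding P_def by (intro prob_space_PiM) unfold_locales
  have A [measurable]: "?A \<in> sets P"
    using assms(1) unfolding P_def
    by (intro sets.sets_Collect_conj pred_beats[unfolded pred_def]) measurable
  have inner: "(\<integral>\<^sup>+x. indicator ?A (x(i := y)) \<partial>?N) = ennreal (?f y)" if y: "0 \<le> pair_min y" for y
  proof -
    \<comment> \<open>The values of coordinate \<open>j\<close> that beat \<open>y\<close>. The
      boundary belongs to the set or not according to \<open>j < i\<close>, without effect on its
      measure.\<close>
    define E where "E j = {w. if j < i then pair_min y \<le> pair_min w else pair_min y < pair_min w}" for j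
    define B where "B j = (if j \<in> S then E j else - E j)" for j
    have E: "E j \<in> sets unit_exponential2" "measure unit_exponential2 (E j) = exp (- 2 * pair_min y)" for j
    proof -
      have "{w \<in> space unit_exponential2. if j < i then pair_min y \<le> pair_min w else pair_min y < pair_min w}
        \<in> sets unit_exponential2"
        by measurable
      then show "E j \<in> sets unit_exponential2"
        by (simp add: E_def space_pair_measure)
      show "measure unit_exponential2 (E j) = exp (- 2 * pair_min y)"
        using measure_unit_exponential2_min[OF y]
        by (cases "j < i") (simp_all only: E_def pair_min_def if_True if_False)
    qed
    have "- E j = space unit_exponential2 - E j" for j
      by (auto simp: space_pair_measure)
    then have B: "B j \<in> sets unit_exponential2"
      "measure unit_exponential2 (B j) =
        (if j \<in> S then exp (- 2 * pair_min y) else 1 - exp (- 2 * pair_min y))" for j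
      using E[of j] unit_exponential2.prob_compl[OF E(1), of j] sets.compl_sets[OF E(1), of j]
      by (auto simp: B_def)
    have "(\<integral>\<^sup>+x. indicator ?A (x(i := y)) \<partial>?N) =
        (\<integral>\<^sup>+x. indicator {..r} (snd y) * indicator (Pi\<^sub>E J B) x \<partial>?N)"
    proof (intro nn_integral_cong)
      fix x assume x: "x \<in> space ?N"
      have "beats (\<lambda>j. pair_min ((x(i := y)) j)) j i \<longleftrightarrow> x j \<in> E j" if "j \<in> J" for j
        using that assms(2) by (auto simp: beats_def E_def)
      \<comment> \<open>The condition at \<open>j = i\<close> holds automatically: \<open>i\<close>
        does not beat itself and does not lie in \<open>S\<close>.\<close>
      then have "(\<forall>j\<in>insert i J. beats (\<lambda>j. pair_min ((x(i := y)) j)) j i \<longleftrightarrow> j \<in> S)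
          \<longleftrightarrow> (\<forall>j\<in>J. x j \<in> B j)"
        using assms(2,3) beats_irrefl by (auto simp: B_def)
      moreover have "x(i := y) \<in> space P" "x \<in> extensional J"
        using x by (auto simp: P_def space_PiM space_pair_measure PiE_def extensional_def)
      ultimately show "indicator ?A (x(i := y)) =
          (indicator {..r} (snd y) * indicator (Pi\<^sub>E J B) x :: ennreal)"
        by (auto simp: indicator_def PiE_iff)
    qed
    also have "\<dots> = indicator {..r} (snd y) * emeasure ?N (Pi\<^sub>E J B)"
      using assms(1) B by (simp add: nn_integral_cmult_indicator sets_PiM_I_finite)
    also have "emeasure ?N (Pi\<^sub>E J B) = (\<Prod>j\<in>J. ennreal (measure unit_exponential2 (B j)))"
      using assms(1) B
      by (simp add: unit_exponential2_PiM.emeasure_PiM unit_exponential2.emeasure_eq_measure)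
    also have "\<dots> = ennreal (\<Prod>j\<in>J. measure unit_exponential2 (B j))"
      by (simp add: prod_ennreal)
    also have "(\<Prod>j\<in>J. measure unit_exponential2 (B j)) =
        exp (- 2 * pair_min y) ^ card S * (1 - exp (- 2 * pair_min y)) ^ card (J - S)"
    proof -
      have "J \<inter> S = S" "J \<inter> - S = J - S" using assms(3) by auto
      then show ?thesis
        using assms(1) by (simp add: B prod.If_cases)
    qed
    also have "indicator {..r} (snd y) *
        ennreal (exp (- 2 * pair_min y) ^ card S * (1 - exp (- 2 * pair_min y)) ^ card (J - S)) =
        ennreal (?f y)"
      by (simp add: indicator_def)
    finally show ?thesis .
  qed
  have nonneg: "AE y in unit_exponential2. 0 \<le> ?f y"
    using AE_unit_exponential2_nonneg
    by eventually_elim (auto simp: pair_min_def)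
  have "emeasure P ?A = (\<integral>\<^sup>+x. indicator ?A x \<partial>P)"
    by (rule nn_integral_indicator[OF A, symmetric])
  also have "\<dots> = (\<integral>\<^sup>+y. (\<integral>\<^sup>+x. indicator ?A (x(i := y)) \<partial>?N) \<partial>unit_exponential2)"
    using A assms(1,2) unfolding P_def
    by (intro unit_exponential2_PiM.product_nn_integral_insert_rev) auto
  also have "\<dots> = (\<integral>\<^sup>+y. ennreal (?f y) \<partial>unit_exponential2)"
    using AE_unit_exponential2_nonneg
    by (intro nn_integral_cong_AE) (elim eventually_mono, rule inner, simp add: pair_min_def)
  also have "\<dots> = ennreal (\<integral>y. ?f y \<partial>unit_exponential2)"
  proof (rule nn_integral_eq_integral[OF _ nonneg])
    show "integrable unit_exponential2 ?f"
    proof (rule unit_exponential2.integrable_const_bound[where B = 1])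
      show "AE y in unit_exponential2. norm (?f y) \<le> 1"
        using AE_unit_exponential2_nonneg
        by eventually_elim
          (auto simp: pair_min_def indicator_def abs_mult power_abs intro!: mult_le_one power_le_one)
    qed measurable
  qed
  finally show ?thesis
    using integral_nonneg_AE[OF nonneg] by (simp add: P.emeasure_eq_measure)
qed

text \<open>The event is a disjoint union over the selected device and the set ranked above it. All
  pieces have equal measure, since that measure depends on the set only through its
  cardinality.\<close>

lemma measure_kth_largest_index:
  assumes "1 \<le> k" and "k \<le> M"
  defines "P \<equiv> PiM {1..M} (\<lambda>_. unit_exponential2)"
  shows "measure P {z \<in> space P. snd (z (kth_largest_index M k (\<lambda>j. pair_min (z j)))) \<le> r}
    = real k * real (M choose k) *
      (\<integral>y. indicator {..r} (snd y) *
        (exp (- 2 * pair_min y) ^ (k - 1) * (1 - exp (- 2 * pair_min y)) ^ (M - k))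
        \<partial>unit_exponential2)" (is "measure P ?A = _ * ?V")
proof -
  interpret P: prob_space P
    unfolding P_def by (intro prob_space_PiM) unfold_locales
  define I where "I = (SIGMA i:{1..M}. {S. S \<subseteq> {1..M} - {i} \<and> card S = k - 1})"
  define F where "F p = {z \<in> space P. snd (z (fst p)) \<le> r \<and>
    (\<forall>j\<in>{1..M}. beats (\<lambda>j. pair_min (z j)) j (fst p) \<longleftrightarrow> j \<in> snd p)}" for p
  have insert: "insert i ({1..M} - {i}) = {1..M}" if "i \<in> {1..M}" for i
    using that by auto
  have F: "F p \<in> sets P" if "p \<in> I" for p
  proof -
    have [measurable]: "fst p \<in> {1..M}"
      using that by (auto simp: I_def)
    show ?thesis
      unfolding P_def F_def
      by (intro sets.sets_Collect_conj pred_beats[unfolded pred_def]) measurable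
  qed
  have measure_F: "measure P (F p) = ?V" if "p \<in> I" for p
  proof -
    obtain i S where p: "p = (i, S)" by fastforce
    with that have iS: "i \<in> {1..M}" "S \<subseteq> {1..M} - {i}" "card S = k - 1"
      by (auto simp: I_def)
    \<comment> \<open>The devices ranked below the selected one: \<open>M - 1\<close> competitors
      less the \<open>k - 1\<close> winners.\<close>
    have "card ({1..M} - {i} - S) = M - k"
      using iS assms by (subst card_Diff_subset) (auto intro: finite_subset)
    then show ?thesis
      using measure_beats_eq[of "{1..M} - {i}" i S r] iS
      unfolding insert[OF iS(1)] by (simp add: F_def P_def p)
  qed
  have "?A = (\<Union>p\<in>I. F p)"
  proof (intro equalityI subsetI)
    fix z assume z: "z \<in> ?A"
    define i where "i = kth_largest_index M k (\<lambda>j. pair_min (z j))"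
    define S where "S = {j \<in> {1..M}. beats (\<lambda>j. pair_min (z j)) j i}"
    have "i \<in> {1..M}" "card S = k - 1"
      using kth_largest_index_eq_iff[OF assms(1,2), of "\<lambda>j. pair_min (z j)" i]
      by (simp_all add: i_def S_def)
    then have "(i, S) \<in> I"
      using beats_irrefl by (auto simp: I_def S_def)
    moreover have "z \<in> F (i, S)"
      using z by (auto simp: F_def S_def i_def)
    ultimately show "z \<in> (\<Union>p\<in>I. F p)"
      by blast
  next
    fix z assume "z \<in> (\<Union>p\<in>I. F p)"
    then obtain i S where iS: "(i, S) \<in> I" "z \<in> F (i, S)"
      by auto
    then have "{j \<in> {1..M}. beats (\<lambda>j. pair_min (z j)) j i} = S"
      by (auto simp: F_def I_def)
    then have "kth_largest_index M k (\<lambda>j. pair_min (z j)) = i"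
      using iS kth_largest_index_eq_iff[OF assms(1,2)] by (auto simp: I_def)
    then show "z \<in> ?A"
      using iS by (auto simp: F_def)
  qed
  moreover have "disjoint_family_on F I"
    unfolding disjoint_family_on_def
  proof (intro ballI impI)
    fix p q assume pq: "p \<in> I" "q \<in> I" "p \<noteq> q"
    \<comment> \<open>An outcome determines its selected index, and that index determines the set of
      devices that beat it.\<close>
    have "p = q" if z: "z \<in> F p" "z \<in> F q" for z
    proof -
      have *: "{j \<in> {1..M}. beats (\<lambda>j. pair_min (z j)) j (fst p')} = snd p'"
        and "kth_largest_index M k (\<lambda>j. pair_min (z j)) = fst p'"
        if "p' \<in> I" "z \<in> F p'" for p'
      proof -
        show "{j \<in> {1..M}. beats (\<lambda>j. pair_min (z j)) j (fst p')} = snd p'"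
          using that by (auto simp: F_def I_def)
        then show "kth_largest_index M k (\<lambda>j. pair_min (z j)) = fst p'"
          using that kth_largest_index_eq_iff[OF assms(1,2)] by (auto simp: I_def)
      qed
      from this[OF pq(1) z(1)] this[OF pq(2) z(2)] show ?thesis
        by (metis prod_eq_iff)
    qed
    then show "F p \<inter> F q = {}"
      using pq(3) by blast
  qed
  moreover have "finite I"
    unfolding I_def by (intro finite_SigmaI) auto
  ultimately have "measure P ?A = (\<Sum>p\<in>I. measure P (F p))"
    using F by (simp add: P.finite_measure_finite_Union image_subset_iff)
  also have "\<dots> = real (card I) * ?V"
    by (simp add: measure_F)
  also have "card I = M * ((M - 1) choose (k - 1))"
    unfolding I_def by (subst card_SigmaI) (auto simp: n_subsets)
  also have "\<dots> = k * (M choose k)"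
    using assms times_binomial_minus1_eq[of k M] by simp
  finally show ?thesis
    by simp
qed

lemma integral_order_statistic:
  assumes "1 \<le> k" and "0 \<le> r"
  shows "(\<integral>y. indicator {..r} (snd y) *
        (exp (- 2 * pair_min y) ^ (k - 1) * (1 - exp (- 2 * pair_min y)) ^ n)
        \<partial>unit_exponential2)
    = (\<Sum>m = 0..n. (- 1) ^ m * real (n choose m) *
       (let \<delta> = real (k + m) in
          (1 - exp (- 2 * \<delta> * r)) / \<delta> - (exp (- r) - exp (- 2 * \<delta> * r)) / (2 * \<delta> - 1)))"
proof -
  \<comment> \<open>The \<open>k - 1\<close> winners and the \<open>m\<close>-th binomial term
    together give \<open>k - 1 + m\<close> factors \<open>exp (- 2 * t)\<close>.\<close>
  let ?q = "\<lambda>m. 2 * real (k + m) - 2"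
  have q: "0 \<le> ?q m" for m
    using assms(1) by simp
  let ?f = "\<lambda>m y. indicator {..r} (snd y) * exp (- ?q m * pair_min y)"
  have "exp (- 2 * t) ^ (k - 1) * (1 - exp (- 2 * t)) ^ n =
      (\<Sum>m = 0..n. (- 1) ^ m * real (n choose m) * exp (- ?q m * t))" for t :: real
  proof -
    have "exp (- 2 * t) ^ (k - 1) * exp (- 2 * t) ^ m = exp (- ?q m * t)" for m
      using assms(1) by (simp add: algebra_simps of_nat_diff flip: exp_of_nat_mult exp_add)
    moreover have "(1 - exp (- 2 * t)) ^ n =
        (\<Sum>m = 0..n. real (n choose m) * ((- 1) ^ m * exp (- 2 * t) ^ m))"
      using binomial_ring[of "- exp (- 2 * t)" 1 n]
      by (simp add: atLeast0AtMost mult.assoc flip: power_mult_distrib)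
    ultimately show ?thesis
      by (simp add: sum_distrib_left mult_ac)
  qed
  then have "(\<integral>y. indicator {..r} (snd y) *
        (exp (- 2 * pair_min y) ^ (k - 1) * (1 - exp (- 2 * pair_min y)) ^ n) \<partial>unit_exponential2)
    = (\<integral>y. (\<Sum>m = 0..n. (- 1) ^ m * real (n choose m) * ?f m y) \<partial>unit_exponential2)"
    by (simp add: sum_distrib_left mult_ac)
  also have "\<dots> = (\<Sum>m = 0..n. (- 1) ^ m * real (n choose m) * (\<integral>y. ?f m y \<partial>unit_exponential2))"
    using integrable_unit_exponential2_exp_min[OF q, of r]
    by (subst Bochner_Integration.integral_sum) (simp_all add: pair_min_def)
  finally have expansion: "(\<integral>y. indicator {..r} (snd y) *
        (exp (- 2 * pair_min y) ^ (k - 1) * (1 - exp (- 2 * pair_min y)) ^ n) \<partial>unit_exponential2)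
    = (\<Sum>m = 0..n. (- 1) ^ m * real (n choose m) * (\<integral>y. ?f m y \<partial>unit_exponential2))" .
  have "(\<integral>y. ?f m y \<partial>unit_exponential2) =
      (let \<delta> = real (k + m) in
        (1 - exp (- 2 * \<delta> * r)) / \<delta> - (exp (- r) - exp (- 2 * \<delta> * r)) / (2 * \<delta> - 1))" for m
  proof -
    define \<delta> where "\<delta> = real (k + m)"
    define u where "u = exp (- 2 * \<delta> * r)"
    have "\<delta> \<noteq> 0" "2 * \<delta> - 1 \<noteq> 0"
      using assms(1) by (auto simp: \<delta>_def)
    \<comment> \<open>With \<open>q = 2 * \<delta> - 2\<close> the rates \<open>q + 1\<close> and
      \<open>q + 2\<close> are \<open>2 * \<delta> - 1\<close> and \<open>2 * \<delta>\<close>. The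
      identity is the partial fraction decomposition of the coefficient of \<open>1 - u\<close> into
      \<open>1 / \<delta> - 1 / (2 * \<delta> - 1)\<close>.\<close>
    then have "(1 - exp (- r)) / (2 * \<delta> - 1) + (2 * \<delta> - 2) / (2 * \<delta> - 1) * ((1 - u) / (2 * \<delta>)) =
        (1 - u) / \<delta> - (exp (- r) - u) / (2 * \<delta> - 1)"
      by (simp add: divide_simps) (simp add: algebra_simps)
    moreover have "(\<integral>y. ?f m y \<partial>unit_exponential2) =
      (1 - exp (- r)) / (2 * \<delta> - 1) + (2 * \<delta> - 2) / (2 * \<delta> - 1) * ((1 - u) / (2 * \<delta>))"
      using integral_unit_exponential2_exp_min[OF q assms(2), of m]
      by (simp add: pair_min_def \<delta>_def u_def)
    ultimately show ?thesis
      unfolding Let_def \<delta>_def[symmetric] u_def[symmetric] by (simp only:)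
  qed
  then show ?thesis
    unfolding expansion by (simp only:)
qed

section \<open>From independent gains to a product law\<close>

text \<open>The blocks \<open>{Inl i, Inr i}\<close> are disjoint, so the subfamilies on them are
  independent, and each pair is a measurable function of its block.\<close>

lemma (in prob_space) indep_vars_pair:
  assumes indep: "indep_vars (\<lambda>_. borel) (case_sum X Y) (I <+> I)"
  shows "indep_vars (\<lambda>_. borel \<Otimes>\<^sub>M borel) (\<lambda>i \<omega>. (X i \<omega> :: 'b :: topological_space, Y i \<omega>)) I"
proof -
  let ?K = "\<lambda>i. {Inl i, Inr i}"
  have "indep_vars (\<lambda>i. PiM (?K i) (\<lambda>_. borel)) (\<lambda>i \<omega>. restrict (\<lambda>j. case_sum X Y j \<omega>) (?K i)) I"
    using indep by (rule indep_vars_restrict) (auto simp: disjoint_family_on_def)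
  then have "indep_vars (\<lambda>_. borel \<Otimes>\<^sub>M borel)
      (\<lambda>i \<omega>. (\<lambda>f. (f (Inl i), f (Inr i))) (restrict (\<lambda>j. case_sum X Y j \<omega>) (?K i))) I"
    by (rule indep_vars_compose2) measurable
  then show ?thesis
    by simp
qed

lemma (in prob_space) distr_pair_eq_pair_measure:
  assumes indep: "indep_vars (\<lambda>_. borel) (case_sum X Y) (I <+> I)" and "i \<in> I"
  shows "distr M (borel \<Otimes>\<^sub>M borel) (\<lambda>\<omega>. (X i \<omega> :: 'b :: topological_space, Y i \<omega>)) =
    distr M borel (X i) \<Otimes>\<^sub>M distr M borel (Y i)"
proof -
  have "indep_var (PiM {Inl i} (\<lambda>_. borel)) (\<lambda>\<omega>. restrict (\<lambda>j. case_sum X Y j \<omega>) {Inl i})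
      (PiM {Inr i} (\<lambda>_. borel)) (\<lambda>\<omega>. restrict (\<lambda>j. case_sum X Y j \<omega>) {Inr i})"
    using indep by (rule indep_var_restrict) (use assms(2) in auto)
  then have "indep_var borel ((\<lambda>f. f (Inl i)) \<circ> (\<lambda>\<omega>. restrict (\<lambda>j. case_sum X Y j \<omega>) {Inl i}))
      borel ((\<lambda>f. f (Inr i)) \<circ> (\<lambda>\<omega>. restrict (\<lambda>j. case_sum X Y j \<omega>) {Inr i}))"
    by (rule indep_var_compose) measurable
  then have "indep_var borel (X i) borel (Y i)"
    by (simp add: comp_def)
  then show ?thesis
    by (simp add: indep_var_distribution_eq)
qed

text \<open>Independence between the pairs makes the joint law a product over \<open>I\<close>;
  independence inside a pair makes each factor a product of two exponential laws. Probabilities can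
  then be computed on the product space.\<close>

lemma (in prob_space) distr_indep_exponential_pairs:
  assumes X: "\<And>i. i \<in> I \<Longrightarrow> distributed M lborel (X i) (exponential_density 1)"
    and Y: "\<And>i. i \<in> I \<Longrightarrow> distributed M lborel (Y i) (exponential_density 1)"
    and indep: "indep_vars (\<lambda>_. borel) (case_sum X Y) (I <+> I)"
    and "I \<noteq> {}"
  shows "(\<lambda>\<omega>. \<lambda>i\<in>I. (X i \<omega>, Y i \<omega>)) \<in> measurable M (PiM I (\<lambda>_. unit_exponential2))"
    and "distr M (PiM I (\<lambda>_. unit_exponential2)) (\<lambda>\<omega>. \<lambda>i\<in>I. (X i \<omega>, Y i \<omega>))
      = PiM I (\<lambda>_. unit_exponential2)"
proof -
  have distr: "distr M borel Z = unit_exponential"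
    if "distributed M lborel Z (exponential_density 1)" for Z
    using distributed_distr_eq_density[OF that] by (simp cong: distr_cong)
  have XY: "(\<lambda>\<omega>. (X i \<omega>, Y i \<omega>)) \<in> measurable M (borel \<Otimes>\<^sub>M borel)" if "i \<in> I" for i
    using indep_vars_pair[OF indep] that by (simp add: indep_vars_def2)
  have sets: "sets (PiM I (\<lambda>_. unit_exponential2)) = sets (PiM I (\<lambda>_. borel \<Otimes>\<^sub>M borel))"
    by (intro sets_PiM_cong sets_pair_measure_cong) auto
  have "(\<lambda>\<omega>. \<lambda>i\<in>I. (X i \<omega>, Y i \<omega>)) \<in> measurable M (PiM I (\<lambda>_. borel \<Otimes>\<^sub>M borel))"
    by (intro measurable_restrict XY)
  then show "(\<lambda>\<omega>. \<lambda>i\<in>I. (X i \<omega>, Y i \<omega>)) \<in> measurable M (PiM I (\<lambda>_. unit_exponential2))"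
    by (subst measurable_cong_sets[OF refl sets])
  have "distr M (PiM I (\<lambda>_. unit_exponential2)) (\<lambda>\<omega>. \<lambda>i\<in>I. (X i \<omega>, Y i \<omega>))
      = distr M (PiM I (\<lambda>_. borel \<Otimes>\<^sub>M borel)) (\<lambda>\<omega>. \<lambda>i\<in>I. (X i \<omega>, Y i \<omega>))"
    by (intro distr_cong sets) auto
  also have "\<dots> = PiM I (\<lambda>i. distr M (borel \<Otimes>\<^sub>M borel) (\<lambda>\<omega>. (X i \<omega>, Y i \<omega>)))"
    using indep_vars_pair[OF indep] XY \<open>I \<noteq> {}\<close>
    by (subst (asm) indep_vars_iff_distr_eq_PiM') auto
  also have "\<dots> = PiM I (\<lambda>_. unit_exponential2)"
    using distr_pair_eq_pair_measure[OF indep] X Y distr by (intro PiM_cong) auto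
  finally show "distr M (PiM I (\<lambda>_. unit_exponential2)) (\<lambda>\<omega>. \<lambda>i\<in>I. (X i \<omega>, Y i \<omega>))
      = PiM I (\<lambda>_. unit_exponential2)" .
qed

subsection \<open>The limit of large transmit power\<close>

text \<open>The exceptional outcomes of the limit: without a positive first gain the harvester need
  not saturate, and at \<open>snd z = r\<close> the limiting SNR equals the threshold, so the
  indicators need not converge to the desired value.\<close>

lemma AE_unit_exponential2_pos_neq:
  "AE z in unit_exponential2. 0 < fst z \<and> snd z \<noteq> r"
proof (rule unit_exponential2.AE_pair_measure)
  show "{z \<in> space unit_exponential2. 0 < fst z \<and> snd z \<noteq> r} \<in> sets unit_exponential2"
    by measurable
  show "AE x in unit_exponential. AE y in unit_exponential. 0 < fst (x, y) \<and> snd (x, y) \<noteq> r"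
    using AE_unit_exponential_nonneg AE_unit_exponential_neq[of 0]
  proof eventually_elim
    case (elim x)
    show ?case
      using AE_unit_exponential_neq[of r] by eventually_elim (use elim in simp)
  qed
qed

text \<open>The selected coordinate is random, but on each of finitely many measurable events, one
  per index and set of winners, it is a fixed coordinate.\<close>

lemma sets_kth_largest_index:
  assumes "1 \<le> k" and "k \<le> M"
    and [measurable]: "Measurable.pred (borel \<Otimes>\<^sub>M borel) Q"
  defines "P \<equiv> PiM {1..M} (\<lambda>_. unit_exponential2)"
  shows "{z \<in> space P. Q (z (kth_largest_index M k (\<lambda>j. pair_min (z j))))} \<in> sets P"
proof -
  define I where "I = (SIGMA i:{1..M}. {S. S \<subseteq> {1..M} \<and> card S = k - 1})"
  have iff: "kth_largest_index M k v = i \<longleftrightarrow>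
      (\<exists>S. (i, S) \<in> I \<and> (\<forall>j\<in>{1..M}. beats v j i \<longleftrightarrow> j \<in> S))" for v i
  proof
    assume "kth_largest_index M k v = i"
    then have "(i, {j \<in> {1..M}. beats v j i}) \<in> I"
      by (auto simp: I_def kth_largest_index_eq_iff[OF assms(1,2)])
    then show "\<exists>S. (i, S) \<in> I \<and> (\<forall>j\<in>{1..M}. beats v j i \<longleftrightarrow> j \<in> S)"
      by blast
  next
    assume "\<exists>S. (i, S) \<in> I \<and> (\<forall>j\<in>{1..M}. beats v j i \<longleftrightarrow> j \<in> S)"
    then obtain S where "i \<in> {1..M}" "card S = k - 1"
      and "S \<subseteq> {1..M}" "\<forall>j\<in>{1..M}. beats v j i \<longleftrightarrow> j \<in> S"
      by (auto simp: I_def)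
    moreover from this(3,4) have "S = {j \<in> {1..M}. beats v j i}"
      by blast
    ultimately show "kth_largest_index M k v = i"
      by (simp add: kth_largest_index_eq_iff[OF assms(1,2)])
  qed
  have "{z \<in> space P. Q (z (kth_largest_index M k (\<lambda>j. pair_min (z j))))} =
    (\<Union>p\<in>I. {z \<in> space P. Q (z (fst p)) \<and>
      (\<forall>j\<in>{1..M}. beats (\<lambda>j. pair_min (z j)) j (fst p) \<longleftrightarrow> j \<in> snd p)})"
  proof (intro equalityI subsetI)
    fix z assume "z \<in> {z \<in> space P. Q (z (kth_largest_index M k (\<lambda>j. pair_min (z j))))}"
    then show "z \<in> (\<Union>p\<in>I. {z \<in> space P. Q (z (fst p)) \<and>
        (\<forall>j\<in>{1..M}. beats (\<lambda>j. pair_min (z j)) j (fst p) \<longleftrightarrow> j \<in> snd p)})"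
      using iff[of "\<lambda>j. pair_min (z j)" "kth_largest_index M k (\<lambda>j. pair_min (z j))"] by force
  next
    fix z assume "z \<in> (\<Union>p\<in>I. {z \<in> space P. Q (z (fst p)) \<and>
        (\<forall>j\<in>{1..M}. beats (\<lambda>j. pair_min (z j)) j (fst p) \<longleftrightarrow> j \<in> snd p)})"
    then obtain i S where "(i, S) \<in> I" "z \<in> space P" "Q (z i)"
      "\<forall>j\<in>{1..M}. beats (\<lambda>j. pair_min (z j)) j i \<longleftrightarrow> j \<in> S"
      by auto
    then show "z \<in> {z \<in> space P. Q (z (kth_largest_index M k (\<lambda>j. pair_min (z j))))}"
      using iff[of "\<lambda>j. pair_min (z j)" i] by auto
  qed
  also have "\<dots> \<in> sets P"
  proof (intro sets.finite_UN)
    show "finite I"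
      unfolding I_def by (intro finite_SigmaI) auto
    fix p assume "p \<in> I"
    then have [measurable]: "fst p \<in> {1..M}"
      by (auto simp: I_def)
    show "{z \<in> space P. Q (z (fst p)) \<and>
        (\<forall>j\<in>{1..M}. beats (\<lambda>j. pair_min (z j)) j (fst p) \<longleftrightarrow> j \<in> snd p)} \<in> sets P"
      unfolding P_def by (intro sets.sets_Collect_conj pred_beats[unfolded pred_def]) measurable
  qed
  finally show ?thesis .
qed

lemma kth_largest_index_cong:
  assumes "1 \<le> k" and "k \<le> M" and "\<And>i. i \<in> {1..M} \<Longrightarrow> v i = w i"
  shows "kth_largest_index M k v = kth_largest_index M k w"
proof -
  have "{j \<in> {1..M}. beats v j i} = {j \<in> {1..M}. beats w j i}" if "i \<in> {1..M}" for i
    using that assms(3) by (auto simp: beats_def)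
  then show ?thesis
    using kth_largest_index_eq_iff[OF assms(1,2), of w "kth_largest_index M k w"]
    by (simp add: kth_largest_index_eq_iff[OF assms(1,2), of v])
qed

text \<open>The SNR converges to its saturated value \<open>?L\<close>. The last hypothesis says
  that \<open>?L\<close> differs from \<open>x\<close>, so the strict comparison of
  \<open>?L\<close> with \<open>x\<close> passes to all large \<open>P\<close>.\<close>

lemma eventually_saturated_snr_le_iff:
  fixes a b c t s x g h :: real
  assumes "0 < c" and "0 < g" and "0 < t" and "0 < s" and "0 < a * c - b"
    and "h \<noteq> s * c * x / (t * (a * c - b))"
  shows "\<forall>\<^sub>F P in at_top. h / s * (t * ((a * P * g + b) / (P * g + c) - b / c)) \<le> x \<longleftrightarrow>
    h \<le> s * c * x / (t * (a * c - b))"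
proof -
  let ?f = "\<lambda>P. h / s * (t * ((a * P * g + b) / (P * g + c) - b / c))"
  let ?L = "h * (t * (a * c - b)) / (s * c)"
  have "filterlim (\<lambda>P. P * g) at_top at_top"
    by (rule filterlim_at_top_mult_tendsto_pos[OF tendsto_const assms(2) filterlim_ident])
  then have "filterlim (\<lambda>P. c + P * g) at_top at_top"
    by (rule filterlim_tendsto_add_at_top[OF tendsto_const])
  then have "((\<lambda>P. ?L * (1 - c * inverse (c + P * g))) \<longlongrightarrow> ?L * (1 - c * 0)) at_top"
    by (intro tendsto_mult tendsto_diff tendsto_const tendsto_inverse_0_at_top)
  moreover have "\<forall>\<^sub>F P in at_top. ?L * (1 - c * inverse (c + P * g)) = ?f P"
    using eventually_ge_at_top[of 0]
  proof eventually_elim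
    case (elim P)
    then have "0 < P * g + c"
      using assms(1,2) by (simp add: add_nonneg_pos)
    \<comment> \<open>Isolates the dependence on \<open>P\<close> in one factor that tends to
      1.\<close>
    then have "(a * P * g + b) / (P * g + c) - b / c = (a * c - b) / c * (1 - c * inverse (c + P * g))"
      using assms(1) by (simp add: divide_simps) (simp add: algebra_simps)
    then show ?case
      by simp
  qed
  ultimately have "(?f \<longlongrightarrow> ?L * (1 - c * 0)) at_top"
    by (rule Lim_transform_eventually)
  then have lim: "(?f \<longlongrightarrow> ?L) at_top"
    by simp
  have less: "?L < x \<longleftrightarrow> h < s * c * x / (t * (a * c - b))"
    "x < ?L \<longleftrightarrow> s * c * x / (t * (a * c - b)) < h"
    using assms by (simp_all add: field_simps)
  show ?thesis
  proof (cases "h < s * c * x / (t * (a * c - b))")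
    case True
    then show ?thesis
      using order_tendstoD(2)[OF lim, of x] less by (auto elim: eventually_mono)
  next
    case False
    then show ?thesis
      using order_tendstoD(1)[OF lim, of x] less assms(6) by (auto elim: eventually_mono)
  qed
qed

theorem mainTheorem13:
  fixes \<Omega> :: "'w measure"
    and M k :: nat
    and g h :: "nat \<Rightarrow> 'w \<Rightarrow> complex"
    and sigma_n t1 t2 a b c x r :: real
  assumes "prob_space \<Omega>"
    and "M \<ge> 1"
    and "\<And>i. i \<in> {1..M} \<Longrightarrow>
           distributed \<Omega> lborel (\<lambda>\<omega>. (cmod (g i \<omega>))\<^sup>2) (exponential_density 1)"
    and "\<And>i. i \<in> {1..M} \<Longrightarrow>
           distributed \<Omega> lborel (\<lambda>\<omega>. (cmod (h i \<omega>))\<^sup>2) (exponential_density 1)"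
    and "prob_space.indep_vars \<Omega> (\<lambda>_. borel)
           (case_sum (\<lambda>i \<omega>. (cmod (g i \<omega>))\<^sup>2) (\<lambda>i \<omega>. (cmod (h i \<omega>))\<^sup>2))
           ({1..M} <+> {1..M})"
    and "sigma_n\<^sup>2 > 0"
    and "0 < t1" and "t1 < 1" and "t2 = 1 - t1"
    and "c > 0" and "a * c - b > 0"
    and "1 \<le> k" and "k \<le> M"
    and "x > 0"
    and "r = sigma_n\<^sup>2 * c * t2 * x / (t1 * (a * c - b))"
  shows "((\<lambda>Pt. Pi_MMS \<Omega> M k g h sigma_n t1 t2 a b c Pt x) \<longlongrightarrow>
           real k * real (M choose k) *
             (\<Sum>m = 0..M - k. (- 1) ^ m * real ((M - k) choose m) *
               (let \<delta> = real (k + m) in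
                  (1 - exp (- 2 * \<delta> * r)) / \<delta>
                  - (exp (- r) - exp (- 2 * \<delta> * r)) / (2 * \<delta> - 1)))) at_top"
proof -
  interpret prob_space \<Omega> by fact
  define P where "P = PiM {1..M} (\<lambda>_::nat. unit_exponential2)"
  interpret P: prob_space P
    unfolding P_def by (intro prob_space_PiM) unfold_locales
  define Z where "Z \<omega> = (\<lambda>i\<in>{1..M}. ((cmod (g i \<omega>))\<^sup>2, (cmod (h i \<omega>))\<^sup>2))" for \<omega>
  have Z: "Z \<in> measurable \<Omega> P" "distr \<Omega> P Z = P"
    using distr_indep_exponential_pairs[OF assms(3,4,5)] assms(2)
    unfolding Z_def[abs_def] P_def by auto
  define best where "best z = z (kth_largest_index M k (\<lambda>j. pair_min (z j)))" for z :: "nat \<Rightarrow> real \<times> real"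
  define X where "X Pt w = snd w / (t2 * sigma_n\<^sup>2) *
    (t1 * ((a * Pt * fst w + b) / (Pt * fst w + c) - b / c))" for Pt and w :: "real \<times> real"
  have "0 < t2 * sigma_n\<^sup>2" "0 \<le> r"
    using assms by auto
  have idx: "kth_largest_index M k v \<in> {1..M}" for v
    using kth_largest_index_eq_iff[OF assms(12,13), of v] by blast
  have X_sets: "{z \<in> space P. X Pt (best z) \<le> x} \<in> sets P" for Pt
    unfolding P_def best_def X_def
    by (rule sets_kth_largest_index[OF assms(12,13)]) measurable
  have r_sets: "{z \<in> space P. snd (best z) \<le> r} \<in> sets P"
    unfolding P_def best_def
    by (rule sets_kth_largest_index[OF assms(12,13)]) measurable
  \<comment> \<open>The outage event depends on the outcome only through \<open>Z\<close>, whose law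
    is \<open>P\<close>; the problem moves to the product space.\<close>
  have Pi: "Pi_MMS \<Omega> M k g h sigma_n t1 t2 a b c Pt x = measure P {z \<in> space P. X Pt (best z) \<le> x}" for Pt
  proof -
    have "best (Z \<omega>) = (let i = mms_index M k (\<lambda>j. g j \<omega>) (\<lambda>j. h j \<omega>)
        in ((cmod (g i \<omega>))\<^sup>2, (cmod (h i \<omega>))\<^sup>2))" for \<omega>
    proof -
      have "kth_largest_index M k (\<lambda>j. pair_min (Z \<omega> j)) = mms_index M k (\<lambda>j. g j \<omega>) (\<lambda>j. h j \<omega>)"
        unfolding mms_index_def
        by (rule kth_largest_index_cong[OF assms(12,13)]) (simp add: Z_def pair_min_def)
      \<comment> \<open>Inside \<open>{1..M}\<close> the restricted function
        \<open>Z \<omega>\<close> returns the actual gains.\<close>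
      moreover have "mms_index M k (\<lambda>j. g j \<omega>) (\<lambda>j. h j \<omega>) \<in> {1..M}"
        unfolding mms_index_def by (rule idx)
      ultimately show ?thesis
        by (simp add: best_def Z_def Let_def)
    qed
    then have "Pi_MMS \<Omega> M k g h sigma_n t1 t2 a b c Pt x =
        measure \<Omega> {\<omega> \<in> space \<Omega>. X Pt (best (Z \<omega>)) \<le> x}"
      by (simp add: Pi_MMS_def snr_def harvested_energy_def X_def Let_def)
    also have "{\<omega> \<in> space \<Omega>. X Pt (best (Z \<omega>)) \<le> x} = Z -` {z \<in> space P. X Pt (best z) \<le> x} \<inter> space \<Omega>"
      using measurable_space[OF Z(1)] by auto
    also have "measure \<Omega> \<dots> = measure (distr \<Omega> P Z) {z \<in> space P. X Pt (best z) \<le> x}"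
      by (rule measure_distr[OF Z(1) X_sets, symmetric])
    finally show ?thesis
      by (simp add: Z(2))
  qed
  \<comment> \<open>Demanded of all devices at once, so that it holds for whichever one is
    selected.\<close>
  have "AE z in P. \<forall>i\<in>{1..M}. 0 < fst (z i) \<and> snd (z i) \<noteq> r"
  proof (rule AE_finite_allI)
    show "AE z in P. 0 < fst (z i) \<and> snd (z i) \<noteq> r" if "i \<in> {1..M}" for i
      unfolding P_def
      by (rule AE_PiM_component[OF _ that AE_unit_exponential2_pos_neq]) unfold_locales
  qed simp
  then have "AE z in P. ((\<lambda>Pt. indicator {z \<in> space P. X Pt (best z) \<le> x} z) \<longlongrightarrow>
      (indicator {z \<in> space P. snd (best z) \<le> r} z :: real)) at_top"
  proof eventually_elim
    case (elim z)
    have "0 < fst (best z)" "snd (best z) \<noteq> r"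
      using elim idx by (auto simp: best_def)
    moreover have "r = t2 * sigma_n\<^sup>2 * c * x / (t1 * (a * c - b))"
      using assms(15) by (simp add: mult_ac)
    ultimately have "\<forall>\<^sub>F Pt in at_top. X Pt (best z) \<le> x \<longleftrightarrow> snd (best z) \<le> r"
      using eventually_saturated_snr_le_iff[OF assms(10) _ assms(7) \<open>0 < t2 * sigma_n\<^sup>2\<close> assms(11)]
      unfolding X_def by simp
    \<comment> \<open>The indicators are eventually constant in \<open>Pt\<close>, hence
      convergent.\<close>
    then show ?case
      by (intro tendsto_eventually) (auto elim!: eventually_mono simp: indicator_def)
  qed
  then have "((\<lambda>Pt. \<integral>z. indicator {z \<in> space P. X Pt (best z) \<le> x} z \<partial>P) \<longlongrightarrow>
      (\<integral>z. (indicator {z \<in> space P. snd (best z) \<le> r} z :: real) \<partial>P)) at_top"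
    using X_sets r_sets
    by (intro integral_dominated_convergence_at_top[where w = "\<lambda>_. 1"]) auto
  then have "((\<lambda>Pt. Pi_MMS \<Omega> M k g h sigma_n t1 t2 a b c Pt x) \<longlongrightarrow>
      measure P {z \<in> space P. snd (best z) \<le> r}) at_top"
    using X_sets r_sets by (simp add: Pi)
  then show ?thesis
    using measure_kth_largest_index[OF assms(12,13), of r]
      integral_order_statistic[OF assms(12) \<open>0 \<le> r\<close>, of "M - k"]
    by (simp only: P_def best_def)
qed

end
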